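(* There is no infinite strictly ascending chain $I_1\subsetneq I_2\subsetneq I_3\subsetneq\cdots$ of tropical ideals in $\overline{\mathbb R}[x_1,\dots,x_n]$.
   Context: $\overline{\mathbb R} = (\mathbb R\cup\{\infty\},\oplus,\odot)$ is the tropical semiring with $\oplus=\min$, $\odot=+$. $\overline{\mathbb R}[x_1,\dots,x_n]$ is the semiring of (formal) polynomials with coefficients in $\overline{\mathbb R}$, with tropical operations; polynomials are not identified with functions. $[f]_{\mathbf x^{\mathbf u}}$ denotes the coefficient of $\mathbf x^{\mathbf u}$ in $f$ (equal to $\infty$ if the monomial does not occur). An ideal of a semiring is a nonempty subset closed under addition and under multiplication by arbitrary elements of the semiring. For an ideal $I$, $I_{\le d}$ is the set of polynomials in $I$ of degree at most $d$. Tropical ideal: an ideal $I\subseteq\overline{\mathbb R}[x_1,\dots,x_n]$ such that for every $d\ge 0$, any $f,g\in I_{\le d}$ and any monomial $\mathbf x^{\mathbf u}$ with $[f]_{\mathbf x^{\mathbf u}}=[g]_{\mathbf x^{\mathbf u}}\ne\infty$, there is $h\in I_{\le d}$ with $[h]_{\mathbf x^{\mathbf u}}=\infty$ and $[h]_{\mathbf x^{\mathbf v}}\ge\min([f]_{\mathbf x^{\mathbf v}},[g]_{\mathbf x^{\mathbf v}})$ for all monomials $\mathbf x^{\mathbf v}$, with equality whenever $[f]_{\mathbf x^{\mathbf v}}\ne[g]_{\mathbf x^{\mathbf v}}$. (Equivalently, each $I_{\le d}$ is the set of vectors of a valuated matroid.) *)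

theory Defs
  imports Complex_Main "HOL-Library.Poly_Mapping"
begin

text \<open>The order on \<open>trop\<close> is the usual one on the reals with \<open>TInf\<close> on top, so it is not
  compatible with the semiring structure in the sense of ordered semirings: the semiring zero
  \<open>TInf\<close> is the greatest element.\<close>

datatype trop = Fin real | TInf

instantiation trop :: linorder
begin

fun less_eq_trop :: "trop \<Rightarrow> trop \<Rightarrow> bool" where
  "x \<le> TInf \<longleftrightarrow> True"
| "TInf \<le> Fin b \<longleftrightarrow> False"
| "Fin a \<le> Fin b \<longleftrightarrow> a \<le> b"

definition less_trop :: "trop \<Rightarrow> trop \<Rightarrow> bool" where
  "x < y \<longleftrightarrow> x \<le> y \<and> \<not> y \<le> (x::trop)"

instance
proof
  fix x y z :: trop
  show "x < y \<longleftrightarrow> x \<le> y \<and> \<not> y \<le> x" by (rule less_trop_def)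
  show "x \<le> x" by (cases x) auto
  show "x \<le> y \<Longrightarrow> y \<le> z \<Longrightarrow> x \<le> z" by (cases x; cases y; cases z) auto
  show "x \<le> y \<Longrightarrow> y \<le> x \<Longrightarrow> x = y" by (cases x; cases y) auto
  show "x \<le> y \<or> y \<le> x" by (cases x; cases y) auto
qed

end

instantiation trop :: comm_semiring_1
begin

definition zero_trop :: trop where "0 = TInf"

definition one_trop :: trop where "1 = Fin 0"

definition plus_trop :: "trop \<Rightarrow> trop \<Rightarrow> trop" where "x + y = min x (y::trop)"

fun times_trop :: "trop \<Rightarrow> trop \<Rightarrow> trop" where
  "Fin a * Fin b = Fin (a + b)"
| "TInf * y = TInf"
| "x * TInf = TInf"

instance
proof
  fix a b c :: trop
  show "a + b + c = a + (b + c)" by (simp add: plus_trop_def min.assoc)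
  show "a + b = b + a" by (simp add: plus_trop_def min.commute)
  show "0 + a = a" by (cases a) (simp_all add: plus_trop_def zero_trop_def min_def)
  show "a * b * c = a * (b * c)" by (cases a; cases b; cases c) simp_all
  show "a * b = b * a" by (cases a; cases b) simp_all
  show "1 * a = a" by (cases a) (simp_all add: one_trop_def)
  show "0 * a = 0" by (simp add: zero_trop_def)
  show "a * 0 = 0" by (cases a) (simp_all add: zero_trop_def)
  show "(a + b) * c = a * c + b * c"
    by (cases a; cases b; cases c) (simp_all add: plus_trop_def min_def)
  show "(0::trop) \<noteq> 1" by (simp add: zero_trop_def one_trop_def)
qed

end

text \<open>Since the zero of \<open>trop\<close> is \<open>TInf\<close>, a polynomial has coefficient \<open>TInf\<close> at all but finitely
  many monomials, \<open>keys\<close> is the set of monomials that occur, and \<open>+\<close> and \<open>*\<close> on \<open>trop_poly\<close> are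
  the tropical operations.  Monomials are exponent vectors; \<open>polys n\<close> consists of the polynomials
  in the variables with indices \<open>1, \<dots>, n\<close>.\<close>

type_synonym monom = "nat \<Rightarrow>\<^sub>0 nat"
type_synonym trop_poly = "monom \<Rightarrow>\<^sub>0 trop"

abbreviation tcoeff :: "trop_poly \<Rightarrow> monom \<Rightarrow> trop" where
  "tcoeff \<equiv> Poly_Mapping.lookup"

definition monoms :: "nat \<Rightarrow> monom set" where
  "monoms n = {u. Poly_Mapping.keys u \<subseteq> {1..n}}"

definition polys :: "nat \<Rightarrow> trop_poly set" where
  "polys n = {f. Poly_Mapping.keys f \<subseteq> monoms n}"

definition monom_deg :: "monom \<Rightarrow> nat" where
  "monom_deg u = (\<Sum>i\<in>Poly_Mapping.keys u. Poly_Mapping.lookup u i)"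

definition poly_ideal :: "nat \<Rightarrow> trop_poly set \<Rightarrow> bool" where
  "poly_ideal n I \<longleftrightarrow> I \<subseteq> polys n \<and> I \<noteq> {} \<and>
     (\<forall>f\<in>I. \<forall>g\<in>I. f + g \<in> I) \<and> (\<forall>p\<in>polys n. \<forall>f\<in>I. p * f \<in> I)"

text \<open>The zero polynomial (all coefficients \<open>TInf\<close>) has degree at most \<open>d\<close> for every \<open>d\<close>.\<close>

definition deg_le :: "trop_poly set \<Rightarrow> nat \<Rightarrow> trop_poly set" where
  "deg_le I d = {f \<in> I. \<forall>u\<in>Poly_Mapping.keys f. monom_deg u \<le> d}"

definition tropical_ideal :: "nat \<Rightarrow> trop_poly set \<Rightarrow> bool" where
  "tropical_ideal n I \<longleftrightarrow> poly_ideal n I \<and>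
     (\<forall>d. \<forall>f\<in>deg_le I d. \<forall>g\<in>deg_le I d. \<forall>u\<in>monoms n.
        tcoeff f u = tcoeff g u \<and> tcoeff f u \<noteq> TInf \<longrightarrow>
        (\<exists>h\<in>deg_le I d. tcoeff h u = TInf \<and>
           (\<forall>v\<in>monoms n. tcoeff h v \<ge> min (tcoeff f v) (tcoeff g v) \<and>
              (tcoeff f v \<noteq> tcoeff g v \<longrightarrow> tcoeff h v = min (tcoeff f v) (tcoeff g v)))))"

end

theory Submission
  imports Defs "HOL-Library.Product_Lexorder"
begin

text \<open>The leading monomials of a tropical ideal, with respect to a graded monomial order that ignores
  the coefficients, are closed under multiplication by monomials.  By Dickson's lemma such sets of
  monomials cannot increase strictly forever, so it suffices that tropical ideals \<open>I \<subseteq> J\<close> with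
  the same leading monomials are equal.  In each degree, the monomials that are not leading form a
  basis of the valuated matroids of both \<open>I\<close> and \<open>J\<close>, which therefore have the same rank; and
  valuated matroids of equal rank whose sets of vectors are nested coincide.\<close>

abbreviation supp :: "('a \<Rightarrow>\<^sub>0 'b::zero) \<Rightarrow> 'a set" where
  "supp \<equiv> Poly_Mapping.keys"

abbreviation coef :: "('a \<Rightarrow>\<^sub>0 'b::zero) \<Rightarrow> 'a \<Rightarrow> 'b" where
  "coef \<equiv> Poly_Mapping.lookup"

subsection \<open>Linear spaces over the tropical semiring\<close>

lemma Fin_neq_0 [simp]: "Fin a \<noteq> 0"
  by (simp add: zero_trop_def)

lemma trop_le_0 [simp]: "(a::trop) \<le> 0"
  by (simp add: zero_trop_def)

lemma trop_0_le_iff [simp]: "0 \<le> (a::trop) \<longleftrightarrow> a = 0"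
  by (metis antisym trop_le_0 order_refl)

lemma trop_no_zero_divisors: "a \<noteq> 0 \<Longrightarrow> b \<noteq> 0 \<Longrightarrow> a * b \<noteq> (0::trop)"
  by (cases a; cases b) (auto simp: zero_trop_def)

lemma coef_single_mult:
  fixes f :: "'a::cancel_comm_monoid_add \<Rightarrow>\<^sub>0 'b::comm_semiring_1"
  shows "coef (Poly_Mapping.single m c * f) (m + u) = c * coef f u"
proof -
  have "Sum_any (\<lambda>q. coef f q when m + u = m + q) = coef f u"
    by (simp add: Sum_any_when_equal)
  then show ?thesis
    by (simp add: lookup_mult lookup_single when_mult)
qed

text \<open>Since the zero of \<^typ>\<open>trop\<close> is infinity, \<open>supp\<close> is the support of a vector, and
  the order of \<^typ>\<open>trop\<close> has \<open>0\<close> on top.\<close>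

locale tropical_space =
  fixes E :: "'a set" and V :: "('a \<Rightarrow>\<^sub>0 trop) set"
  assumes supp_carrier: "f \<in> V \<Longrightarrow> supp f \<subseteq> E"
    and zero_mem: "0 \<in> V"
    and add_mem: "f \<in> V \<Longrightarrow> g \<in> V \<Longrightarrow> f + g \<in> V"
    and scale_mem: "f \<in> V \<Longrightarrow> Poly_Mapping.map ((*) c) f \<in> V"
    and elim: "f \<in> V \<Longrightarrow> g \<in> V \<Longrightarrow> coef f u = coef g u \<Longrightarrow> coef f u \<noteq> 0 \<Longrightarrow>
      \<exists>h\<in>V. coef h u = 0 \<and> (\<forall>v. min (coef f v) (coef g v) \<le> coef h v \<and>
        (coef f v \<noteq> coef g v \<longrightarrow> coef h v = min (coef f v) (coef g v)))"
begin

text \<open>Independence in the matroid underlying \<open>V\<close>, whose circuits are the minimal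
  supports of nonzero vectors.\<close>

definition indep :: "'a set \<Rightarrow> bool" where
  "indep A \<longleftrightarrow> (\<forall>f\<in>V. supp f \<subseteq> A \<longrightarrow> f = 0)"

text \<open>Spanning in the same matroid. A vector through \<open>x\<close> is asked for instead of
  a circuit, which spares passing to minimal supports.\<close>

definition spans :: "'a set \<Rightarrow> bool" where
  "spans A \<longleftrightarrow> (\<forall>x\<in>E - A. \<exists>f\<in>V. x \<in> supp f \<and> supp f \<subseteq> insert x A)"

lemma coef_scale [simp]: "coef (Poly_Mapping.map ((*) (c::trop)) f) u = c * coef f u"
  by (simp add: Poly_Mapping.map.rep_eq when_def)

lemma supp_scale: "c \<noteq> 0 \<Longrightarrow> supp (Poly_Mapping.map ((*) (c::trop)) f) = supp f"
  by (auto simp: in_keys_iff trop_no_zero_divisors)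

lemma ex_scale:
  assumes "f \<in> V" "u \<in> supp f" "c \<noteq> 0"
  shows "\<exists>g\<in>V. supp g = supp f \<and> coef g u = c"
proof -
  obtain a b where ab: "coef f u = Fin a" "c = Fin b"
    using assms(2,3) by (cases "coef f u"; cases c) (auto simp: in_keys_iff zero_trop_def)
  let ?g = "Poly_Mapping.map ((*) (Fin (b - a))) f"
  have "?g \<in> V" "supp ?g = supp f" "coef ?g u = c"
    using assms(1) ab by (simp_all add: scale_mem supp_scale)
  then show ?thesis by blast
qed

text \<open>Strong circuit elimination, for supports of vectors: scale \<open>g\<close> to agree
  with \<open>f\<close> at \<open>a\<close> and eliminate there. The entry at \<open>u\<close>
  survives because it is finite in \<open>f\<close> and infinite in \<open>g\<close>.\<close>

lemma supp_elim:
  assumes f: "f \<in> V" "a \<in> supp f" "u \<in> supp f" and g: "g \<in> V" "a \<in> supp g" "u \<notin> supp g"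
  shows "\<exists>h\<in>V. u \<in> supp h \<and> supp h \<subseteq> supp f \<union> supp g - {a}"
proof -
  obtain g' where g': "g' \<in> V" "supp g' = supp g" "coef g' a = coef f a"
    using ex_scale[OF g(1,2), of "coef f a"] f(2) by (auto simp: in_keys_iff)
  then obtain h where h: "h \<in> V" "coef h a = 0"
    "\<And>v. min (coef f v) (coef g' v) \<le> coef h v"
    "\<And>v. coef f v \<noteq> coef g' v \<Longrightarrow> coef h v = min (coef f v) (coef g' v)"
    using elim[OF f(1) g'(1) g'(3)[symmetric]] f(2) by (metis in_keys_iff)
  have "coef g' u = 0"
    using g(3) g'(2) by (metis in_keys_iff)
  then have "coef h u = coef f u"
    using h(4)[of u] f(3) by (simp add: in_keys_iff min_def)
  then have "u \<in> supp h"
    using f(3) by (simp add: in_keys_iff)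
  moreover have "supp h \<subseteq> supp f \<union> supp g - {a}"
  proof
    fix v assume "v \<in> supp h"
    then have "coef h v \<noteq> 0" by (simp add: in_keys_iff)
    moreover from this have "v \<noteq> a" using h(2) by auto
    ultimately have "v \<in> supp f \<union> supp g'"
      using h(3)[of v] by (auto simp: in_keys_iff min_def)
    then show "v \<in> supp f \<union> supp g - {a}"
      using \<open>v \<noteq> a\<close> g'(2) by auto
  qed
  ultimately show ?thesis using h(1) by blast
qed

lemma indep_insert:
  assumes "indep A" "x \<notin> A" "\<not> indep (insert x A)"
  shows "\<exists>f\<in>V. x \<in> supp f \<and> supp f \<subseteq> insert x A"
  using assms unfolding indep_def by blast

text \<open>Steinitz exchange: an element of \<open>S - I\<close> is traded for one of \<open>I - S\<close>, and \<open>S\<close> stays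
  spanning.\<close>

lemma indep_card_le:
  assumes "finite E" "S \<subseteq> E" "spans S" "I \<subseteq> E" "indep I"
  shows "card I \<le> card S"
  using assms(2,3)
proof (induction "card (I - S)" arbitrary: S rule: less_induct)
  case less
  have finS: "finite S" using less.prems(1) assms(1) finite_subset by blast
  have finI: "finite I" using assms(1,4) finite_subset by blast
  show ?case
  proof (cases "I \<subseteq> S")
    case True
    then show ?thesis using finS by (simp add: card_mono)
  next
    case False
    then obtain e where e: "e \<in> I" "e \<notin> S" by blast
    then obtain v where v: "v \<in> V" "e \<in> supp v" "supp v \<subseteq> insert e S"
      using less.prems(2) assms(4) unfolding spans_def by blast
    \<comment> \<open>The nonzero vector \<open>v\<close> cannot be supported inside the independent
      set \<open>I\<close>.\<close>
    then obtain s where s: "s \<in> supp v" "s \<notin> I"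
      using assms(5) unfolding indep_def by fastforce
    then have sS: "s \<in> S" using v e by auto
    let ?T = "insert e (S - {s})"
    have "spans ?T"
      unfolding spans_def
    proof
      fix x assume x: "x \<in> E - ?T"
      show "\<exists>f\<in>V. x \<in> supp f \<and> supp f \<subseteq> insert x ?T"
      proof (cases "x = s")
        case True
        then show ?thesis using v s by (intro bexI[of _ v]) auto
      next
        case False
        then have "x \<in> E - S" using x by auto
        then obtain w where w: "w \<in> V" "x \<in> supp w" "supp w \<subseteq> insert x S"
          using less.prems(2) unfolding spans_def by blast
        show ?thesis
        proof (cases "s \<in> supp w")
          case True
          \<comment> \<open>Eliminating \<open>s\<close> between \<open>w\<close> and
            \<open>v\<close> keeps \<open>x\<close> and brings in only \<open>e\<close> and elements
            of \<open>S - {s}\<close>.\<close>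
          have "x \<notin> supp v" using x v False by auto
          then obtain h where "h \<in> V" "x \<in> supp h" "supp h \<subseteq> supp w \<union> supp v - {s}"
            using supp_elim[OF w(1) True w(2) v(1) s(1)] by blast
          then show ?thesis using w(3) v(3) by (intro bexI[of _ h]) auto
        next
          case False
          then show ?thesis using w by (intro bexI[of _ w]) auto
        qed
      qed
    qed
    moreover have "card (I - ?T) < card (I - S)"
      using e s finI by (intro psubset_card_mono) auto
    moreover have "?T \<subseteq> E" using less.prems(1) e assms(4) by auto
    ultimately have "card I \<le> card ?T" using less.hyps by blast
    also have "\<dots> = card S"
      using e sS finS by (simp add: card.insert_remove card_Diff_singleton)
        (metis card_gt_0_iff empty_iff Suc_pred)
    finally show ?thesis .
  qed
qed

text \<open>A maximal independent set containing \<open>A\<close> is spanning, since adding any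
  further element creates a dependency through it.\<close>

lemma ex_indep_spanning_superset:
  assumes "finite E" "A \<subseteq> E" "indep A"
  shows "\<exists>B. A \<subseteq> B \<and> B \<subseteq> E \<and> indep B \<and> spans B"
proof -
  let ?F = "{B. A \<subseteq> B \<and> B \<subseteq> E \<and> indep B}"
  have "finite ?F"
    by (rule finite_subset[of _ "Pow E"]) (auto simp: assms(1))
  moreover have "?F \<noteq> {}"
    using assms(2,3) by blast
  ultimately obtain B where B: "B \<in> ?F" "\<And>C. C \<in> ?F \<Longrightarrow> B \<subseteq> C \<Longrightarrow> B = C"
    by (meson finite_has_maximal)
  have "spans B"
    unfolding spans_def
  proof
    fix x assume x: "x \<in> E - B"
    then have "\<not> indep (insert x B)" using B(1) B(2)[of "insert x B"] by auto
    then show "\<exists>f\<in>V. x \<in> supp f \<and> supp f \<subseteq> insert x B"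
      using x B(1) by (intro indep_insert) auto
  qed
  then show ?thesis using B(1) by blast
qed

text \<open>By the cardinality bound \<open>C\<close> cannot be enlarged independently, so every
  further element depends on it.\<close>

lemma indep_spans:
  assumes "finite E" "B \<subseteq> E" "spans B" "C \<subseteq> E" "indep C" "card B \<le> card C"
  shows "spans C"
  unfolding spans_def
proof
  fix x assume x: "x \<in> E - C"
  have "finite C" using assms(1,4) finite_subset by blast
  then have "card (insert x C) > card B" using x assms(6) by auto
  then have "\<not> indep (insert x C)"
    using indep_card_le[OF assms(1-3), of "insert x C"] x assms(4) by auto
  then show "\<exists>f\<in>V. x \<in> supp f \<and> supp f \<subseteq> insert x C"
    using x assms(5) by (intro indep_insert) auto
qed

section \<open>Reconstructing and rescaling vectors\<close>

text \<open>The tropical sum, a coordinatewise minimum, of vectors lying above \<open>w\<close> and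
  touching it at each point of its support is \<open>w\<close> itself.\<close>

lemma mem_if_locally_generated:
  assumes "\<And>u. u \<in> supp w \<Longrightarrow> \<exists>v\<in>V. coef v u = coef w u \<and> (\<forall>x. coef w x \<le> coef v x)"
  shows "w \<in> V"
proof -
  have "\<exists>g\<in>V. (\<forall>u\<in>K. coef g u = coef w u) \<and> (\<forall>x. coef w x \<le> coef g x)"
    if "K \<subseteq> supp w" for K
    using finite_subset[OF that finite_keys] that
  proof (induction K rule: finite_induct)
    case empty
    show ?case by (intro bexI[OF _ zero_mem]) simp
  next
    case (insert u K)
    then obtain g where g: "g \<in> V" "\<forall>u\<in>K. coef g u = coef w u" "\<forall>x. coef w x \<le> coef g x"
      by blast
    obtain v where v: "v \<in> V" "coef v u = coef w u" "\<forall>x. coef w x \<le> coef v x"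
      using assms insert.prems by blast
    have "g + v \<in> V" using g v by (simp add: add_mem)
    moreover have "\<forall>x\<in>insert u K. coef (g + v) x = coef w x"
      using g(2,3) v(2,3) by (simp add: lookup_add plus_trop_def min_absorb1 min_absorb2)
    moreover have "\<forall>x. coef w x \<le> coef (g + v) x"
      using g(3) v(3) by (simp add: lookup_add plus_trop_def)
    ultimately show ?case by blast
  qed
  from this[OF order_refl] obtain g where g: "g \<in> V" "\<forall>u\<in>supp w. coef g u = coef w u"
    "\<forall>x. coef w x \<le> coef g x" by blast
  have "coef g x = coef w x" for x
  proof (cases "x \<in> supp w")
    case False
    then have "coef w x = 0" by (simp add: in_keys_iff)
    moreover from this have "coef g x = 0"
      using g(3)[rule_format, of x] by simp
    ultimately show ?thesis by simp
  qed (use g(2) in blast)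
  then have "g = w" by (rule poly_mapping_eqI)
  then show ?thesis using g by simp
qed

text \<open>Lower \<open>z\<close> by a scalar as far as it can go while staying above
  \<open>w\<close>; it then meets \<open>w\<close> somewhere on its support.\<close>

lemma ex_scale_touching:
  assumes "z \<in> V" "z \<noteq> 0" "supp z \<subseteq> supp w"
  shows "\<exists>z'\<in>V. supp z' = supp z \<and> (\<forall>x. coef w x \<le> coef z' x) \<and>
    (\<exists>a\<in>supp z. coef z' a = coef w a)"
proof -
  \<comment> \<open>The value at \<open>TInf\<close> is a dummy: \<open>r\<close> is evaluated only
    at finite coefficients.\<close>
  define r where "r = (\<lambda>t. case t of Fin a \<Rightarrow> a | TInf \<Rightarrow> 0)"
  have Fin_r: "coef f x = Fin (r (coef f x))" if "x \<in> supp f" for f :: "'a \<Rightarrow>\<^sub>0 trop" and x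
    using that by (cases "coef f x") (auto simp: r_def in_keys_iff zero_trop_def)
  define d where "d = (\<lambda>x. r (coef w x) - r (coef z x))"
  have fin: "finite (d ` supp z)" "d ` supp z \<noteq> {}"
    using assms(2) by auto
  \<comment> \<open>The least shift that lifts \<open>z\<close> above \<open>w\<close>; a point
    attaining the maximum is a contact point.\<close>
  define c where "c = Max (d ` supp z)"
  have c_in: "c \<in> d ` supp z" unfolding c_def by (rule Max_in[OF fin])
  have c_ge: "d x \<le> c" if "x \<in> supp z" for x
    unfolding c_def using fin(1) that by (intro Max_ge) auto
  let ?z = "Poly_Mapping.map ((*) (Fin c)) z"
  have "coef w x \<le> coef ?z x" for x
  proof (cases "x \<in> supp z")
    case True
    then have "coef w x = Fin (r (coef w x))" "coef z x = Fin (r (coef z x))"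
      using assms(3) Fin_r by auto
    then have "coef w x \<le> coef ?z x \<longleftrightarrow> r (coef w x) \<le> c + r (coef z x)"
      by (metis coef_scale times_trop.simps(1) less_eq_trop.simps(3))
    then show ?thesis using c_ge[OF True] by (simp add: d_def)
  next
    case False
    then show ?thesis by (simp add: in_keys_iff)
  qed
  moreover obtain a where a: "a \<in> supp z" "c = d a" using c_in by auto
  have "coef w a = Fin (r (coef w a))" "coef z a = Fin (r (coef z a))"
    using a assms(3) Fin_r by auto
  moreover have "Fin (r (coef w a)) = Fin c * Fin (r (coef z a))"
    by (simp add: a d_def)
  ultimately have "coef ?z a = coef w a" by (metis coef_scale)
  moreover have "?z \<in> V" "supp ?z = supp z" using assms(1) by (simp_all add: scale_mem supp_scale)
  ultimately show ?thesis
    using \<open>\<And>x. coef w x \<le> coef ?z x\<close> a(1) by blast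
qed

end

text \<open>Containment of the sets of vectors makes the matroid of \<open>W\<close> a quotient of
  that of \<open>V\<close>, hence the name.\<close>

locale tropical_quotient = V: tropical_space E V + W: tropical_space E W
  for E :: "'a set" and V W +
  assumes finite_carrier: "finite E"
    and sub: "V \<subseteq> W"
begin

text \<open>A vector \<open>w\<close> of minimal support is the unique vector of \<open>W\<close>, up to scaling, supported on a
  basis \<open>B'\<close> of \<open>W\<close> together with \<open>u\<close>; as the ranks agree, \<open>B'\<close> is also a basis of \<open>V\<close>, and the
  corresponding vector of \<open>V\<close> must be \<open>w\<close>.  Otherwise \<open>w\<close> is reduced by elimination to vectors of
  smaller support.\<close>

lemma locally_generated:
  assumes B: "B \<subseteq> E" "V.spans B" "W.indep B"
    and w: "w \<in> W" "u \<in> supp w"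
  shows "\<exists>v\<in>V. coef v u = coef w u \<and> (\<forall>x. coef w x \<le> coef v x)"
  using w
proof (induction "card (supp w)" arbitrary: w rule: less_induct)
  case less
  note w = less.prems
  \<comment> \<open>A vector of \<open>V\<close> above \<open>h\<close> and touching it at
    \<open>u\<close> does the same for \<open>w\<close>.\<close>
  have smaller: ?case if h: "h \<in> W" "coef h u = coef w u" "\<And>x. coef w x \<le> coef h x"
    "supp h \<subset> supp w" for h
  proof -
    have "card (supp h) < card (supp w)" using h(4) by (simp add: psubset_card_mono)
    moreover have "u \<in> supp h" using h(2) w(2) by (simp add: in_keys_iff)
    ultimately obtain v where "v \<in> V" "coef v u = coef h u" "\<forall>x. coef h x \<le> coef v x"
      using less.hyps h(1) by blast
    then show ?thesis using h(2,3) by (metis order_trans)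
  qed
  show ?case
  proof (cases "\<exists>z\<in>W. z \<noteq> 0 \<and> supp z \<subset> supp w")
    case True
    then obtain z0 where z0: "z0 \<in> W" "z0 \<noteq> 0" "supp z0 \<subset> supp w" by blast
    then obtain z a where z: "z \<in> W" "supp z = supp z0" "\<And>x. coef w x \<le> coef z x"
      and a: "a \<in> supp z0" "coef z a = coef w a"
      using W.ex_scale_touching[of z0 w] by blast
    show ?thesis
    proof (cases "coef z u = coef w u")
      case True
      then show ?thesis using smaller[of z] z z0(3) by simp
    next
      case False
      \<comment> \<open>Eliminate \<open>a\<close> between \<open>w\<close> and \<open>z\<close>.
        Since \<open>z\<close> lies above \<open>w\<close> and differs from it at \<open>u\<close>,
        the result lies above \<open>w\<close>, keeps its entry at \<open>u\<close> and loses
        \<open>a\<close>.\<close>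
      have "coef w a \<noteq> 0" using a z0(3) by (metis in_keys_iff psubsetD)
      then obtain h where h: "h \<in> W" "coef h a = 0"
        "\<And>v. min (coef w v) (coef z v) \<le> coef h v"
        "\<And>v. coef w v \<noteq> coef z v \<Longrightarrow> coef h v = min (coef w v) (coef z v)"
        using W.elim[OF w(1) z(1) a(2)[symmetric]] by blast
      have "coef h u = coef w u"
        using h(4)[of u] False z(3)[of u] by (simp add: min_absorb1)
      moreover have h_ge: "coef w x \<le> coef h x" for x
        using h(3)[of x] z(3)[of x] by (simp add: min_absorb1)
      moreover have "supp h \<subset> supp w"
      proof
        show "supp h \<subseteq> supp w"
        proof
          fix x assume "x \<in> supp h"
          then show "x \<in> supp w" using h_ge[of x] by (metis in_keys_iff trop_0_le_iff)
        qed
        show "supp h \<noteq> supp w" using h(2) \<open>coef w a \<noteq> 0\<close> by (metis in_keys_iff)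
      qed
      ultimately show ?thesis using smaller[of h] h(1) by blast
    qed
  next
    case False
    have "W.indep (supp w - {u})"
      unfolding W.indep_def using False w(2) by blast
    moreover have "supp w - {u} \<subseteq> E" using W.supp_carrier[OF w(1)] by blast
    ultimately obtain B' where B': "supp w - {u} \<subseteq> B'" "B' \<subseteq> E" "W.indep B'" "W.spans B'"
      using W.ex_indep_spanning_superset finite_carrier by metis
    \<comment> \<open>Independence passes from \<open>W\<close> down to \<open>V\<close>, so this
      inequality makes \<open>B'\<close> spanning for \<open>V\<close> as well.\<close>
    have "card B \<le> card B'"
      by (rule W.indep_card_le[OF finite_carrier B'(2,4) B(1,3)])
    moreover have "V.indep B'"
      using B'(3) sub unfolding V.indep_def W.indep_def by blast
    ultimately have "V.spans B'"
      using V.indep_spans[OF finite_carrier B(1,2) B'(2)] by blast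
    have "u \<notin> B'"
    proof
      assume "u \<in> B'"
      then have "supp w \<subseteq> B'" using B'(1) by blast
      then have "w = 0" using B'(3) w(1) unfolding W.indep_def by blast
      then show False using w(2) by simp
    qed
    then have "u \<in> E - B'" using W.supp_carrier[OF w(1)] w(2) by blast
    then obtain v0 where v0: "v0 \<in> V" "u \<in> supp v0" "supp v0 \<subseteq> insert u B'"
      using \<open>V.spans B'\<close> unfolding V.spans_def by blast
    have "coef w u \<noteq> 0" using w(2) by (simp add: in_keys_iff)
    then obtain v where v: "v \<in> V" "supp v = supp v0" "coef v u = coef w u"
      using V.ex_scale[OF v0(1,2)] by blast
    then have "v \<in> W" using sub by blast
    \<comment> \<open>Eliminating \<open>u\<close> leaves a vector supported on the independent set
      \<open>B'\<close>, hence zero; the equality clause of elimination then forces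
      \<open>v = w\<close>.\<close>
    then obtain h where h: "h \<in> W" "coef h u = 0"
      "\<And>x. min (coef w x) (coef v x) \<le> coef h x"
      "\<And>x. coef w x \<noteq> coef v x \<Longrightarrow> coef h x = min (coef w x) (coef v x)"
      using W.elim[OF w(1) _ v(3)[symmetric] \<open>coef w u \<noteq> 0\<close>] by blast
    have "supp h \<subseteq> B'"
    proof
      fix x assume "x \<in> supp h"
      then have "coef h x \<noteq> 0" by (simp add: in_keys_iff)
      then have "x \<noteq> u" using h(2) by blast
      have "coef w x \<noteq> 0 \<or> coef v x \<noteq> 0"
        using h(3)[of x] \<open>coef h x \<noteq> 0\<close> by auto
      then have "x \<in> supp w \<union> supp v" by (simp add: in_keys_iff)
      then show "x \<in> B'" using \<open>x \<noteq> u\<close> B'(1) v(2) v0(3) by blast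
    qed
    then have "h = 0" using B'(3) h(1) unfolding W.indep_def by blast
    have "v = w"
    proof (rule poly_mapping_eqI, rule ccontr)
      fix x assume "coef v x \<noteq> coef w x"
      moreover from this have "min (coef w x) (coef v x) = 0"
        using h(4)[of x] \<open>h = 0\<close> by simp
      ultimately show False by (metis min_def trop_0_le_iff trop_le_0)
    qed
    then show ?thesis using v(1) by blast
  qed
qed

text \<open>As \<open>V\<close> is contained in \<open>W\<close>, such a \<open>B\<close> is also
  independent for \<open>V\<close> and spanning for \<open>W\<close>: a basis of both, so the ranks
  agree.\<close>

lemma eq_if_common_basis:
  assumes "B \<subseteq> E" "V.spans B" "W.indep B"
  shows "V = W"
  using sub V.mem_if_locally_generated locally_generated[OF assms] by blast

end

subsection \<open>Leading terms\<close>

text \<open>The key \<open>k\<close> supplies the order, so that monomials can be compared by degree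
  first without changing the order of their type.\<close>

definition leading :: "('a \<Rightarrow> 'k::linorder) \<Rightarrow> ('a \<Rightarrow>\<^sub>0 'b::zero) set \<Rightarrow> 'a set" where
  "leading k V = {u. \<exists>f\<in>V. u \<in> supp f \<and> (\<forall>v\<in>supp f. k v \<le> k u)}"

lemma leading_mono: "V \<subseteq> W \<Longrightarrow> leading k V \<subseteq> leading k W"
  unfolding leading_def by blast

context tropical_space
begin

text \<open>The support of a nonzero vector contains its own leading element.\<close>

lemma indep_if_disjoint_leading:
  assumes "A \<inter> leading k V = {}"
  shows "indep A"
  unfolding indep_def
proof (intro ballI impI, rule ccontr)
  fix f assume f: "f \<in> V" "supp f \<subseteq> A" "f \<noteq> 0"
  let ?m = "Max (k ` supp f)"
  have "?m \<in> k ` supp f" using f(3) by (intro Max_in) auto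
  then obtain u where u: "u \<in> supp f" "?m = k u" by blast
  have "\<forall>v\<in>supp f. k v \<le> k u" using u(2)[symmetric] by simp
  then have "u \<in> leading k V" using u f(1) unfolding leading_def by blast
  then show False using assms u(1) f(2) by blast
qed

text \<open>The analogue of an element of a reduced Groebner basis: apart from \<open>x\<close>, no
  leading element occurs. The outer induction supplies reduced vectors for smaller leading
  elements.\<close>

lemma ex_reduced:
  assumes "finite E" "inj k" "x \<in> leading k V"
  shows "\<exists>f\<in>V. x \<in> supp f \<and> supp f \<subseteq> insert x (E - leading k V) \<and> (\<forall>y\<in>supp f. k y \<le> k x)"
  using assms(3)
proof (induction "card {y\<in>E. k y < k x}" arbitrary: x rule: less_induct)
  case (less x)
  let ?L = "leading k V"
  have reduce: "\<exists>h\<in>V. x \<in> supp h \<and> supp h \<subseteq> insert x (E - ?L) \<and> (\<forall>y\<in>supp h. k y \<le> k x)"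
    if "f \<in> V" "x \<in> supp f" "\<forall>y\<in>supp f. k y \<le> k x" for f
    using that
  proof (induction "card (supp f \<inter> ?L)" arbitrary: f rule: less_induct)
    case (less f)
    note f = less.prems
    show ?case
    proof (cases "supp f \<inter> ?L \<subseteq> {x}")
      case True
      then have "supp f \<subseteq> insert x (E - ?L)" using supp_carrier[OF f(1)] by blast
      then show ?thesis using f by blast
    next
      case False
      then obtain y where y: "y \<in> supp f" "y \<in> ?L" "y \<noteq> x" by blast
      have "k y < k x"
        using f(3) y(1,3) assms(2) by (metis injD order_le_less)
      moreover have "y \<in> E" using supp_carrier[OF f(1)] y(1) by blast
      ultimately have "{z\<in>E. k z < k y} \<subset> {z\<in>E. k z < k x}" by auto
      then have "card {z\<in>E. k z < k y} < card {z\<in>E. k z < k x}"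
        using assms(1) by (intro psubset_card_mono) auto
      then obtain g where g: "g \<in> V" "y \<in> supp g" "supp g \<subseteq> insert y (E - ?L)"
        "\<forall>z\<in>supp g. k z \<le> k y"
        using \<open>\<And>xa. card {y \<in> E. k y < k xa} < card {y \<in> E. k y < k x} \<Longrightarrow> xa \<in> ?L \<Longrightarrow> _\<close> y(2)
        by blast
      \<comment> \<open>Apart from \<open>y\<close>, the support of \<open>g\<close> has no leading
        elements, so eliminating \<open>y\<close> keeps \<open>x\<close> and adds no new
        ones.\<close>
      have "x \<notin> supp g" using g(3) y(3) \<open>x \<in> ?L\<close> by blast
      then obtain h where h: "h \<in> V" "x \<in> supp h" "supp h \<subseteq> supp f \<union> supp g - {y}"
        using supp_elim[OF f(1) y(1) f(2) g(1,2)] by blast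
      have "supp h \<inter> ?L \<subset> supp f \<inter> ?L"
        using h(3) g(3) y(1,2) by blast
      then have "card (supp h \<inter> ?L) < card (supp f \<inter> ?L)"
        by (intro psubset_card_mono) auto
      moreover have "\<forall>z\<in>supp h. k z \<le> k x"
        using h(3) f(3) g(4) \<open>k y < k x\<close> by fastforce
      ultimately show ?thesis using less.hyps[OF _ h(1,2)] by blast
    qed
  qed
  show ?case using less.prems reduce unfolding leading_def by blast
qed

lemma spans_compl_leading:
  assumes "finite E" "inj k"
  shows "spans (E - leading k V)"
  unfolding spans_def using ex_reduced[OF assms] by blast

end

text \<open>The complement of the common leading set serves as the common basis.\<close>

lemma (in tropical_quotient) eq_if_leading_eq:
  assumes "inj k" "leading k V = leading k W"
  shows "V = W"
proof (rule eq_if_common_basis)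
  show "V.spans (E - leading k V)"
    by (rule V.spans_compl_leading[OF finite_carrier assms(1)])
  show "W.indep (E - leading k V)"
    by (rule W.indep_if_disjoint_leading[of _ k]) (use assms(2) in blast)
qed blast

subsection \<open>Monomials\<close>

lemma mono_subseq_nat:
  fixes s :: "nat \<Rightarrow> nat"
  shows "\<exists>r :: nat \<Rightarrow> nat. strict_mono r \<and> mono (\<lambda>i. s (r i))"
proof -
  obtain r where r: "strict_mono r" "monoseq (\<lambda>i. s (r i))" using seq_monosub by blast
  show ?thesis
  proof (cases "mono (\<lambda>i. s (r i))")
    case True
    then show ?thesis using r(1) by blast
  next
    case False
    then have dec: "decseq (\<lambda>i. s (r i))" using r(2) by (simp add: monoseq_iff)
    \<comment> \<open>A decreasing sequence of naturals is constant from the place where its minimum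
      is attained.\<close>
    obtain N where N: "\<And>i. s (r N) \<le> s (r i)"
      using ex_has_least_nat[of "\<lambda>_. True" 0 "\<lambda>i. s (r i)"] by blast
    have "s (r (N + i)) = s (r N)" for i
      using N[of "N + i"] decseqD[OF dec, of N "N + i"] by simp
    then have "mono (\<lambda>i. s (r (N + i)))" by (simp add: mono_def)
    moreover have "strict_mono (\<lambda>i. r (N + i))" using r(1) by (simp add: strict_mono_def)
    ultimately show ?thesis by (intro exI[of _ "\<lambda>i. r (N + i)"]) simp
  qed
qed

lemma mono_subseq_nat_family:
  fixes s :: "'b \<Rightarrow> nat \<Rightarrow> nat"
  assumes "finite K"
  shows "\<exists>r :: nat \<Rightarrow> nat. strict_mono r \<and> (\<forall>k\<in>K. mono (\<lambda>i. s k (r i)))"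
  using assms
proof (induction K rule: finite_induct)
  case empty
  show ?case by (intro exI[of _ id]) (simp add: strict_mono_def)
next
  case (insert x K)
  then obtain r :: "nat \<Rightarrow> nat" where r: "strict_mono r" "\<forall>k\<in>K. mono (\<lambda>i. s k (r i))" by blast
  obtain q :: "nat \<Rightarrow> nat" where q: "strict_mono q" "mono (\<lambda>i. s x (r (q i)))"
    using mono_subseq_nat[of "\<lambda>i. s x (r i)"] by blast
  have "mono (\<lambda>i. s k (r (q i)))" if "k \<in> K" for k
  proof (rule monoI)
    fix i j :: nat assume "i \<le> j"
    then have "q i \<le> q j" using q(1) by (simp add: strict_mono_less_eq)
    then show "s k (r (q i)) \<le> s k (r (q j))" using r(2) that by (blast dest: monoD)
  qed
  moreover have "strict_mono (\<lambda>i. r (q i))" using r(1) q(1) by (simp add: strict_mono_def)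
  ultimately show ?case using q(2) by (intro exI[of _ "\<lambda>i. r (q i)"]) blast
qed

text \<open>Pass to a subsequence along which all \<open>n\<close> exponents are nondecreasing; its
  first two terms already divide.\<close>

lemma dickson:
  fixes u :: "nat \<Rightarrow> monom"
  assumes "\<And>i. u i \<in> monoms n"
  shows "\<exists>i j m. i < j \<and> m \<in> monoms n \<and> u j = m + u i"
proof -
  obtain r :: "nat \<Rightarrow> nat" where r: "strict_mono r" "\<forall>k\<in>{1..n}. mono (\<lambda>i. coef (u (r i)) k)"
    using mono_subseq_nat_family[of "{1..n}" "\<lambda>k i. coef (u i) k"] by auto
  let ?v = "u (r 0)" and ?w = "u (r 1)"
  have le: "coef ?v k \<le> coef ?w k" for k
  proof (cases "k \<in> {1..n}")
    case True
    then show ?thesis using r(2) by (auto simp: mono_def)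
  next
    case False
    then have "k \<notin> supp ?v" using assms[of "r 0"] unfolding monoms_def by blast
    then show ?thesis by (simp add: in_keys_iff)
  qed
  have "?w = (?w - ?v) + ?v"
    by (rule poly_mapping_eqI) (use le in \<open>simp add: lookup_add lookup_minus\<close>)
  moreover have "?w - ?v \<in> monoms n"
    using assms[of "r 1"] unfolding monoms_def by (auto simp: in_keys_iff lookup_minus)
  moreover have "r 0 < r 1" using r(1) by (simp add: strict_mono_def)
  ultimately show ?thesis by blast
qed

section \<open>Degrees and the graded order\<close>

lemma monom_deg_eq_sum:
  assumes "finite K" "supp u \<subseteq> K"
  shows "monom_deg u = (\<Sum>i\<in>K. coef u i)"
  unfolding monom_deg_def using assms
  by (intro sum.mono_neutral_left) (auto simp: in_keys_iff)

lemma monom_deg_add: "monom_deg (u + v) = monom_deg u + monom_deg v"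
proof -
  let ?K = "supp u \<union> supp v"
  have "supp (u + v) \<subseteq> ?K" by (rule keys_add)
  then have "monom_deg (u + v) = (\<Sum>i\<in>?K. coef (u + v) i)"
    by (intro monom_deg_eq_sum) simp_all
  also have "\<dots> = (\<Sum>i\<in>?K. coef u i) + (\<Sum>i\<in>?K. coef v i)"
    by (simp only: lookup_add sum.distrib)
  also have "\<dots> = monom_deg u + monom_deg v"
    using monom_deg_eq_sum[of ?K u] monom_deg_eq_sum[of ?K v] by simp
  finally show ?thesis .
qed

lemma coef_le_monom_deg: "coef u i \<le> monom_deg u"
proof (cases "i \<in> supp u")
  case True
  then show ?thesis unfolding monom_deg_def by (rule member_le_sum) simp_all
next
  case False
  then show ?thesis by (simp add: in_keys_iff)
qed

lemma finite_monoms_deg_le: "finite {u \<in> monoms n. monom_deg u \<le> d}"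
proof -
  let ?S = "{u \<in> monoms n. monom_deg u \<le> d}"
  let ?F = "{f. \<forall>x. (x \<in> {1..n} \<longrightarrow> f x \<in> {0..d}) \<and> (x \<notin> {1..n} \<longrightarrow> f x = (0::nat))}"
  have "coef u \<in> ?F" if "u \<in> ?S" for u
  proof -
    have "coef u x \<le> d" for x using coef_le_monom_deg[of u x] that by simp
    moreover have "coef u x = 0" if "x \<notin> {1..n}" for x
    proof -
      have "x \<notin> supp u" using that \<open>u \<in> ?S\<close> unfolding monoms_def by blast
      then show ?thesis by (simp add: in_keys_iff)
    qed
    ultimately show ?thesis by simp
  qed
  then have "coef ` ?S \<subseteq> ?F" by (rule image_subsetI)
  moreover have "finite ?F" by (rule finite_set_of_finite_funs) auto
  ultimately have "finite (coef ` ?S)" by (rule finite_subset)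
  moreover have "inj_on coef ?S" by (rule inj_onI) (metis poly_mapping_eqI)
  ultimately show ?thesis by (rule finite_imageD)
qed

text \<open>Pairs are compared lexicographically: degree first, ties broken by the order on
  \<open>monom\<close>. Grading makes leading monomials compatible with truncation by
  degree.\<close>

definition grlex :: "monom \<Rightarrow> nat \<times> monom" where
  "grlex u = (monom_deg u, u)"

lemma inj_grlex: "inj grlex"
  by (simp add: inj_def grlex_def)

lemma grlex_add_left_mono: "grlex u \<le> grlex v \<Longrightarrow> grlex (w + u) \<le> grlex (w + v)"
  using add_left_mono[of u v w] by (auto simp: grlex_def monom_deg_add)

subsection \<open>Tropical ideals\<close>

lemma tropical_space_deg_le:
  assumes "tropical_ideal n I"
  shows "tropical_space {u \<in> monoms n. monom_deg u \<le> d} (deg_le I d)"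
proof
  have I: "I \<subseteq> polys n" "I \<noteq> {}" "\<And>f g. f \<in> I \<Longrightarrow> g \<in> I \<Longrightarrow> f + g \<in> I"
    "\<And>p f. p \<in> polys n \<Longrightarrow> f \<in> I \<Longrightarrow> p * f \<in> I"
    using assms unfolding tropical_ideal_def poly_ideal_def by blast+
  show "supp f \<subseteq> {u \<in> monoms n. monom_deg u \<le> d}" if "f \<in> deg_le I d" for f
    using that I(1) unfolding deg_le_def polys_def by blast
  obtain f where "f \<in> I" using I(2) by blast
  moreover have "0 \<in> polys n" by (simp add: polys_def)
  ultimately have "0 * f \<in> I" using I(4) by blast
  then show "0 \<in> deg_le I d" by (simp add: deg_le_def)
  show "f + g \<in> deg_le I d" if "f \<in> deg_le I d" "g \<in> deg_le I d" for f g
    using that I(3) keys_add[of f g] unfolding deg_le_def by blast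
  show "Poly_Mapping.map ((*) c) f \<in> deg_le I d" if f: "f \<in> deg_le I d" for f c
  proof -
    \<comment> \<open>Scaling by \<open>c\<close> is multiplication by a constant
      polynomial.\<close>
    have "Poly_Mapping.single 0 c \<in> polys n"
      by (auto simp: polys_def monoms_def)
    then have "Poly_Mapping.map ((*) c) f \<in> I"
      using f I(4) by (simp add: mult_map_scale_conv_mult deg_le_def)
    moreover have "supp (Poly_Mapping.map ((*) c) f) \<subseteq> supp f"
      by (auto simp: in_keys_iff Poly_Mapping.map.rep_eq when_def)
    ultimately show ?thesis using f unfolding deg_le_def by blast
  qed
  show "\<exists>h\<in>deg_le I d. coef h u = 0 \<and> (\<forall>v. min (coef f v) (coef g v) \<le> coef h v \<and>
      (coef f v \<noteq> coef g v \<longrightarrow> coef h v = min (coef f v) (coef g v)))"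
    if fg: "f \<in> deg_le I d" "g \<in> deg_le I d" "coef f u = coef g u" "coef f u \<noteq> 0" for f g u
  proof -
    have outside: "coef p v = 0" if "p \<in> deg_le I d" "v \<notin> monoms n" for p v
    proof -
      have "v \<notin> supp p" using that I(1) unfolding deg_le_def polys_def by blast
      then show ?thesis by (simp add: in_keys_iff)
    qed
    have "u \<in> monoms n" using outside[OF fg(1)] fg(4) by blast
    with assms fg have "\<exists>h\<in>deg_le I d. coef h u = 0 \<and> (\<forall>v\<in>monoms n.
        min (coef f v) (coef g v) \<le> coef h v \<and>
        (coef f v \<noteq> coef g v \<longrightarrow> coef h v = min (coef f v) (coef g v)))"
      unfolding tropical_ideal_def zero_trop_def by simp
    then obtain h where h: "h \<in> deg_le I d" "coef h u = 0"
      "\<And>v. v \<in> monoms n \<Longrightarrow> min (coef f v) (coef g v) \<le> coef h v \<and>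
        (coef f v \<noteq> coef g v \<longrightarrow> coef h v = min (coef f v) (coef g v))"
      by blast
    \<comment> \<open>Elimination is given on \<open>monoms n\<close> only; elsewhere all three
      coefficients are infinite.\<close>
    have "min (coef f v) (coef g v) \<le> coef h v \<and>
        (coef f v \<noteq> coef g v \<longrightarrow> coef h v = min (coef f v) (coef g v))" for v
      by (cases "v \<in> monoms n") (simp_all add: h outside fg(1,2))
    then show ?thesis using h(1,2) by blast
  qed
qed

text \<open>In a graded order the degree of the leading monomial bounds the degree of the whole
  polynomial.\<close>

lemma leading_deg_le:
  "leading grlex (deg_le I d) = {u \<in> leading grlex I. monom_deg u \<le> d}"
proof (intro equalityI subsetI)
  fix u assume "u \<in> {u \<in> leading grlex I. monom_deg u \<le> d}"
  then obtain f where f: "f \<in> I" "u \<in> supp f" "\<forall>v\<in>supp f. grlex v \<le> grlex u" "monom_deg u \<le> d"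
    unfolding leading_def by blast
  then have "\<forall>v\<in>supp f. monom_deg v \<le> d" by (fastforce simp: grlex_def)
  then show "u \<in> leading grlex (deg_le I d)"
    using f unfolding leading_def deg_le_def by blast
qed (auto simp: leading_def deg_le_def)

text \<open>Multiplying by a monomial with coefficient \<open>1\<close> translates the support by
  \<open>m\<close> and preserves the order.\<close>

lemma leading_add:
  assumes "tropical_ideal n I" "u \<in> leading grlex I" "m \<in> monoms n"
  shows "m + u \<in> leading grlex I"
proof -
  obtain f where f: "f \<in> I" "u \<in> supp f" "\<forall>v\<in>supp f. grlex v \<le> grlex u"
    using assms(2) unfolding leading_def by blast
  let ?p = "Poly_Mapping.single m (1::trop)"
  have "?p \<in> polys n" using assms(3) by (simp add: polys_def)
  then have "?p * f \<in> I"
    using assms(1) f(1) unfolding tropical_ideal_def poly_ideal_def by blast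
  moreover have "m + u \<in> supp (?p * f)"
    using f(2) by (simp add: in_keys_iff coef_single_mult)
  moreover have "\<forall>v\<in>supp (?p * f). grlex v \<le> grlex (m + u)"
  proof
    fix v assume "v \<in> supp (?p * f)"
    then obtain v' where "v' \<in> supp f" "v = m + v'"
      using keys_mult[of ?p f] by auto
    then show "grlex v \<le> grlex (m + u)" using f(3) grlex_add_left_mono by blast
  qed
  ultimately show ?thesis unfolding leading_def by blast
qed

lemma tropical_ideal_eq_if_leading_eq:
  assumes "tropical_ideal n I" "tropical_ideal n J" "I \<subseteq> J" "leading grlex I = leading grlex J"
  shows "I = J"
proof
  show "J \<subseteq> I"
  proof
    fix f assume f: "f \<in> J"
    \<comment> \<open>A crude degree bound, used instead of a maximum because it also covers the
      zero polynomial.\<close>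
    let ?d = "\<Sum>u\<in>supp f. monom_deg u"
    let ?E = "{u \<in> monoms n. monom_deg u \<le> ?d}"
    have "f \<in> deg_le J ?d" using f by (simp add: deg_le_def member_le_sum)
    moreover interpret tropical_quotient ?E "deg_le I ?d" "deg_le J ?d"
      by (intro tropical_quotient.intro tropical_quotient_axioms.intro tropical_space_deg_le
          assms(1,2) finite_monoms_deg_le) (use assms(3) in \<open>auto simp: deg_le_def\<close>)
    have "deg_le I ?d = deg_le J ?d"
      by (rule eq_if_leading_eq[OF inj_grlex]) (simp add: leading_deg_le assms(4))
    ultimately have "f \<in> deg_le I ?d" by simp
    then show "f \<in> I" by (simp add: deg_le_def)
  qed
qed fact

theorem theorem1p3:
  fixes n :: nat
  shows "\<not> (\<exists>I :: nat \<Rightarrow> trop_poly set.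
            (\<forall>i. tropical_ideal n (I i)) \<and> (\<forall>i. I i \<subset> I (Suc i)))"
proof
  assume "\<exists>I :: nat \<Rightarrow> trop_poly set.
            (\<forall>i. tropical_ideal n (I i)) \<and> (\<forall>i. I i \<subset> I (Suc i))"
  then obtain I :: "nat \<Rightarrow> trop_poly set"
    where I: "\<And>i. tropical_ideal n (I i)" "\<And>i. I i \<subset> I (Suc i)" by blast
  have "\<exists>u. u \<in> leading grlex (I (Suc i)) \<and> u \<notin> leading grlex (I i)" for i
    using tropical_ideal_eq_if_leading_eq[OF I(1) I(1), of i "Suc i"] I(2)[of i]
      leading_mono[of "I i" "I (Suc i)" grlex] by blast
  then obtain u where u: "\<And>i. u i \<in> leading grlex (I (Suc i))" "\<And>i. u i \<notin> leading grlex (I i)"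
    by metis
  have "u i \<in> monoms n" for i
    using u(1)[of i] I(1)[of "Suc i"]
    unfolding leading_def tropical_ideal_def poly_ideal_def polys_def by blast
  then obtain i j m where ij: "i < j" "m \<in> monoms n" "u j = m + u i"
    using dickson by blast
  \<comment> \<open>Thus \<open>u i\<close> is leading for \<open>I j\<close>, and so is its
    multiple \<open>u j\<close>, against the choice of \<open>u j\<close>.\<close>
  have "I (Suc i) \<subseteq> I j"
    using lift_Suc_mono_le[of I "Suc i" j] I(2) ij(1) by (simp add: psubset_imp_subset Suc_le_eq)
  then have "u i \<in> leading grlex (I j)"
    using u(1) leading_mono by blast
  then show False
    using leading_add[OF I(1) _ ij(2)] ij(3) u(2)[of j] by auto
qed

end
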